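(* Let $A$ be a point or vector configuration of rank $r$ and let $T$ index a non-empty partial triangulation of $A$. If $T$ is right-extendable, then for each $f\in\mathrm{free}(T)$ there is a multi-covering set of simplex indices $C(f)\subseteq\mathrm{adm}(T)$ (the $f$-covering simplices) such that (i) for each $f\in\mathrm{free}(T)$ there is an $s_f\in C(f)$ that, for all $f'\in\mathrm{free}(T)$, is identical to or intersects properly with at least one $s_{f'}\in C(f')$; (ii) for all $f\in\mathrm{free}(T)$ and all $s_f\in C(f)$ one has $f\in\mathrm{intfacets}(s_f)$.
   Context: $A\in\mathbb{R}^{r\times n}$ has rank $r$ and columns $a_1,\dots,a_n$ (points in homogeneous coordinates, or vectors). A circuit is an inclusion-minimal linearly dependent set $C$ of column indices; a circuit signature splits $C=C_+\cup C_-$ such that $\sum_{i\in C_+}\lambda_ia_i=\sum_{i\in C_-}\lambda_ia_i$ for some $\lambda_i>0$, and $(C_+,C_-)$ is a signed circuit (each circuit yields two opposite ones). A cocircuit is an inclusion-maximal index set $C_0^*$ with $\operatorname{rank}(A_{C_0^*})<r$; with a non-zero $c\in\mathbb{R}^r$ satisfying $c^\top a_i=0$ exactly for $i\in C_0^*$ put $C_\pm^*=\{i:\pm c^\top a_i>0\}$. A simplex is an index set $S$ of size $r$ with $\operatorname{rank}(A_S)=r$; its facets are its $(r-1)$-subsets. Two simplices $S_1,S_2$ intersect properly if there is no signed circuit with $C_+\subseteq S_1$ and $C_-\subseteq S_2$. A simplex facet $F$ is interior if there is a cocircuit $C_0^*\supseteq F$ with $C_+^*$ and $C_-^*$ both non-empty.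 A triangulation is a non-empty set $\mathcal{T}$ of pairwise properly intersecting (feasible) simplices that is covering: for each interior facet $F$ of some $S\in\mathcal{T}$ there is another $S'\in\mathcal{T}$ containing $F$. A partial triangulation is a set of pairwise properly intersecting (feasible) simplices. (The set of feasible simplices, the ones considered in the enumeration, may be all simplices or a restricted set depending on the enumeration task.) Lexicographic order on sets of integers: $\emptyset\prec S$ for $S\ne\emptyset$; for non-empty $S,R$: $S\prec R$ iff $\min S<\min R$, or the minima agree and $S\setminus\{\min S\}\prec R\setminus\{\min R\}$. The $N$ feasible simplices are numbered $1,\dots,N$ in increasing lexicographic order, and the $M$ interior simplex facets are numbered $1,\dots,M$ in increasing lexicographic order; simplices and facets are identified with their numbers, and $T\subseteq\{1,\dots,N\}$ indexes the corresponding set of simplices. For $s\in\{1,\dots,N\}$, $\mathrm{intfacets}(s)\subseteq\{1,\dots,M\}$ is the set of (numbers of) interior facets of simplex $s$. For $T$ indexing a partial triangulation, $\mathrm{adm}(T)$ is the set of all $s\in\{1,\dots,N\}$ such that for all $s'\in T$: $s>s'$ and simplex $s$ intersects simplex $s'$ properly; $\mathrm{free}(T)$ is the set of $f\in\{1,\dots,M\}$ with $f\in\mathrm{intfacets}(s)$ for exactly one $s\in T$. $T$ is right-extendable if there is a $T'\supseteq T$ indexing a triangulation such that every element of $T'\setminus T$ is larger than every element of $T$. *)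

theory Defs
  imports "HOL-Analysis.Analysis"
begin

(* A configuration is a matrix A :: real^'n^'r with r = CARD('r) rows and n = CARD('n) columns
   column i A. The linear order of the finite index type 'n plays the role of the usual order
   on the column indices 1, ..., n. *)

definition subrank :: "real^'n^'r \<Rightarrow> 'n set \<Rightarrow> nat" where
  "subrank A S = dim ((\<lambda>i. column i A) ` S)"

(* Dependence of the indexed family of columns: the library's "dependent" speaks about sets of
   vectors and would not see repeated columns. *)
definition dependent_columns :: "real^'n^'r \<Rightarrow> 'n set \<Rightarrow> bool" where
  "dependent_columns A C \<longleftrightarrow>
     (\<exists>\<mu> :: 'n \<Rightarrow> real. (\<exists>i\<in>C. \<mu> i \<noteq> 0) \<and> (\<Sum>i\<in>C. \<mu> i *\<^sub>R column i A) = 0)"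

definition circuit :: "real^'n^'r \<Rightarrow> 'n set \<Rightarrow> bool" where
  "circuit A C \<longleftrightarrow> dependent_columns A C \<and> (\<forall>D. D \<subset> C \<longrightarrow> \<not> dependent_columns A D)"

definition signed_circuit :: "real^'n^'r \<Rightarrow> 'n set \<Rightarrow> 'n set \<Rightarrow> bool" where
  "signed_circuit A Cp Cm \<longleftrightarrow>
     circuit A (Cp \<union> Cm) \<and> Cp \<inter> Cm = {} \<and>
     (\<exists>w :: 'n \<Rightarrow> real. (\<forall>i\<in>Cp \<union> Cm. w i > 0) \<and>
        (\<Sum>i\<in>Cp. w i *\<^sub>R column i A) = (\<Sum>i\<in>Cm. w i *\<^sub>R column i A))"

definition cocircuit :: "real^'n^'r \<Rightarrow> 'n set \<Rightarrow> bool" where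
  "cocircuit A C0 \<longleftrightarrow>
     subrank A C0 < CARD('r) \<and> (\<forall>D. C0 \<subset> D \<longrightarrow> \<not> subrank A D < CARD('r))"

definition cocircuit_signature :: "real^'n^'r \<Rightarrow> 'n set \<Rightarrow> 'n set \<Rightarrow> 'n set \<Rightarrow> bool" where
  "cocircuit_signature A C0 Cp Cm \<longleftrightarrow>
     cocircuit A C0 \<and>
     (\<exists>c :: real^'r. c \<noteq> 0 \<and> (\<forall>i. c \<bullet> column i A = 0 \<longleftrightarrow> i \<in> C0) \<and>
        Cp = {i. c \<bullet> column i A > 0} \<and> Cm = {i. - (c \<bullet> column i A) > 0})"

definition simplex_of :: "real^'n^'r \<Rightarrow> 'n set \<Rightarrow> bool" where
  "simplex_of A S \<longleftrightarrow> card S = CARD('r) \<and> subrank A S = CARD('r)"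

definition facets :: "'n::finite set \<Rightarrow> 'n set set" where
  "facets S = {F. F \<subseteq> S \<and> card F = card S - 1}"

definition intersect_properly :: "real^'n^'r \<Rightarrow> 'n set \<Rightarrow> 'n set \<Rightarrow> bool" where
  "intersect_properly A S1 S2 \<longleftrightarrow>
     \<not> (\<exists>Cp Cm. signed_circuit A Cp Cm \<and> Cp \<subseteq> S1 \<and> Cm \<subseteq> S2)"

definition interior_face :: "real^'n^'r \<Rightarrow> 'n set \<Rightarrow> bool" where
  "interior_face A F \<longleftrightarrow>
     (\<exists>C0 Cp Cm. cocircuit_signature A C0 Cp Cm \<and> F \<subseteq> C0 \<and> Cp \<noteq> {} \<and> Cm \<noteq> {})"

definition interior_simplex_facets :: "real^'n^'r \<Rightarrow> 'n set set" where
  "interior_simplex_facets A = {F. (\<exists>S. simplex_of A S \<and> F \<in> facets S) \<and> interior_face A F}"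

(* Feas is the set of feasible simplices. *)
definition partial_triangulation :: "real^'n^'r \<Rightarrow> 'n set set \<Rightarrow> 'n set set \<Rightarrow> bool" where
  "partial_triangulation A Feas \<T> \<longleftrightarrow>
     \<T> \<subseteq> Feas \<and> (\<forall>S\<in>\<T>. simplex_of A S) \<and>
     (\<forall>S1\<in>\<T>. \<forall>S2\<in>\<T>. S1 \<noteq> S2 \<longrightarrow> intersect_properly A S1 S2)"

definition covering :: "real^'n^'r \<Rightarrow> 'n set set \<Rightarrow> bool" where
  "covering A \<T> \<longleftrightarrow>
     (\<forall>S\<in>\<T>. \<forall>F\<in>facets S. interior_face A F \<longrightarrow> (\<exists>S'\<in>\<T>. S' \<noteq> S \<and> F \<subseteq> S'))"

definition triangulation :: "real^'n^'r \<Rightarrow> 'n set set \<Rightarrow> 'n set set \<Rightarrow> bool" where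
  "triangulation A Feas \<T> \<longleftrightarrow>
     \<T> \<noteq> {} \<and> partial_triangulation A Feas \<T> \<and> covering A \<T>"

(* Only meaningful for finite sets, because of Min. *)
inductive lex_less :: "'a::linorder set \<Rightarrow> 'a set \<Rightarrow> bool" where
  empty: "S \<noteq> {} \<Longrightarrow> lex_less {} S"
| Min: "S \<noteq> {} \<Longrightarrow> R \<noteq> {} \<Longrightarrow> Min S < Min R \<Longrightarrow> lex_less S R"
| step: "S \<noteq> {} \<Longrightarrow> R \<noteq> {} \<Longrightarrow> Min S = Min R \<Longrightarrow>
           lex_less (S - {Min S}) (R - {Min R}) \<Longrightarrow> lex_less S R"

definition lex_index :: "'a::linorder set set \<Rightarrow> 'a set \<Rightarrow> nat" where
  "lex_index \<C> S = card {R\<in>\<C>. lex_less R S \<or> R = S}"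

(* lex_nth \<C> k is the k-th member of \<C> in increasing lexicographic order, 1 \<le> k \<le> card \<C>;
   see bij_betw_lex_nth and lex_nth_increasing. *)
definition lex_nth :: "'a::linorder set set \<Rightarrow> nat \<Rightarrow> 'a set" where
  "lex_nth \<C> = inv_into \<C> (lex_index \<C>)"

lemma lex_less_iff:
  assumes "finite (S :: 'a::linorder set)" "finite R"
  shows "lex_less S R \<longleftrightarrow>
    (sorted_list_of_set S, sorted_list_of_set R) \<in> lexord {(x, y). x < y}"
  using assms
proof (induction "card S" arbitrary: S R rule: less_induct)
  case less
  show ?case
  proof (cases "S = {} \<or> R = {}")
    case True
    then show ?thesis
      using less.prems lex_less.cases[of S R] lex_less.empty[of R]
      by (cases "S = {}"; cases "R = {}") (auto simp: sorted_list_of_set_nonempty)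
  next
    case False
    then have ne: "S \<noteq> {}" "R \<noteq> {}" by auto
    have "card (S - {Min S}) < card S"
      using ne less.prems by (intro card_Diff1_less) auto
    then have IH: "lex_less (S - {Min S}) (R - {Min R}) \<longleftrightarrow>
        (sorted_list_of_set (S - {Min S}), sorted_list_of_set (R - {Min R}))
          \<in> lexord {(x, y). x < y}"
      using less.hyps less.prems by simp
    have "lex_less S R \<longleftrightarrow> Min S < Min R \<or>
        Min S = Min R \<and> lex_less (S - {Min S}) (R - {Min R})"
      using ne lex_less.cases[of S R] lex_less.Min[of S R] lex_less.step[of S R] by metis
    then show ?thesis
      using ne less.prems IH by (simp add: sorted_list_of_set_nonempty)
  qed
qed

lemma lex_less_irrefl: "finite S \<Longrightarrow> \<not> lex_less S S"
  by (simp add: lex_less_iff lexord_irreflexive)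

lemma lex_less_trans:
  fixes S R Q :: "'a::linorder set"
  assumes "finite S" "finite R" "finite Q" "lex_less S R" "lex_less R Q"
  shows "lex_less S Q"
proof -
  have "trans {(x :: 'a, y). x < y}" by (auto intro: transI)
  then show ?thesis using assms by (auto simp: lex_less_iff intro: lexord_trans)
qed

lemma lex_less_linear:
  fixes S R :: "'a::linorder set"
  assumes "finite S" "finite R" "S \<noteq> R"
  shows "lex_less S R \<or> lex_less R S"
proof -
  have "sorted_list_of_set S \<noteq> sorted_list_of_set R"
    using assms sorted_list_of_set.set_sorted_key_list_of_set by metis
  then show ?thesis
    using assms lexord_linear[of "{(x :: 'a, y). x < y}"
        "sorted_list_of_set S" "sorted_list_of_set R"]
    by (simp add: lex_less_iff) (metis neqE)
qed

lemma lex_index_less: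
  assumes "finite \<C>" "\<And>S. S \<in> \<C> \<Longrightarrow> finite S" "S \<in> \<C>" "R \<in> \<C>" "lex_less S R"
  shows "lex_index \<C> S < lex_index \<C> R"
  unfolding lex_index_def
proof (rule psubset_card_mono)
  show "{Q \<in> \<C>. lex_less Q S \<or> Q = S} \<subset> {Q \<in> \<C>. lex_less Q R \<or> Q = R}"
  proof (rule psubsetI)
    show "{Q \<in> \<C>. lex_less Q S \<or> Q = S} \<subseteq> {Q \<in> \<C>. lex_less Q R \<or> Q = R}"
      using assms(2-5) lex_less_trans[of _ S R] by auto
    have "\<not> lex_less R S" "R \<noteq> S"
      using assms(2-5) lex_less_trans[of S R S] lex_less_irrefl[of S] by auto
    then have "R \<notin> {Q \<in> \<C>. lex_less Q S \<or> Q = S}" by simp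
    moreover have "R \<in> {Q \<in> \<C>. lex_less Q R \<or> Q = R}" using assms(4) by simp
    ultimately show "{Q \<in> \<C>. lex_less Q S \<or> Q = S} \<noteq> {Q \<in> \<C>. lex_less Q R \<or> Q = R}"
      by metis
  qed
qed (use assms in simp)

lemma bij_betw_lex_index:
  assumes "finite \<C>" "\<And>S. S \<in> \<C> \<Longrightarrow> finite S"
  shows "bij_betw (lex_index \<C>) \<C> {1..card \<C>}"
proof -
  have inj: "inj_on (lex_index \<C>) \<C>"
    using assms lex_index_less lex_less_linear by (metis inj_onI less_irrefl)
  have "lex_index \<C> ` \<C> \<subseteq> {1..card \<C>}"
  proof (intro subsetI, elim imageE)
    fix k S assume *: "S \<in> \<C>" "k = lex_index \<C> S"
    have "card {S} \<le> lex_index \<C> S" unfolding lex_index_def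
      by (rule card_mono) (use * assms in auto)
    moreover have "lex_index \<C> S \<le> card \<C>" unfolding lex_index_def
      by (rule card_mono) (use assms in auto)
    ultimately show "k \<in> {1..card \<C>}" using * by simp
  qed
  then have "lex_index \<C> ` \<C> = {1..card \<C>}"
    by (rule card_subset_eq[rotated]) (auto simp: card_image[OF inj])
  with inj show ?thesis by (simp add: bij_betw_def)
qed

lemma bij_betw_lex_nth:
  assumes "finite \<C>" "\<And>S. S \<in> \<C> \<Longrightarrow> finite S"
  shows "bij_betw (lex_nth \<C>) {1..card \<C>} \<C>"
  unfolding lex_nth_def by (rule bij_betw_inv_into[OF bij_betw_lex_index[OF assms]])

lemma lex_nth_increasing:
  assumes "finite \<C>" "\<And>S. S \<in> \<C> \<Longrightarrow> finite S"
    and "j \<in> {1..card \<C>}" "k \<in> {1..card \<C>}" "j < k"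
  shows "lex_less (lex_nth \<C> j) (lex_nth \<C> k)"
proof -
  have mem: "lex_nth \<C> j \<in> \<C>" "lex_nth \<C> k \<in> \<C>"
    using bij_betw_lex_nth[OF assms(1,2)] assms(3,4) by (auto simp: bij_betw_def)
  have "lex_index \<C> (lex_nth \<C> j) = j" "lex_index \<C> (lex_nth \<C> k) = k"
    using bij_betw_inv_into_right[OF bij_betw_lex_index[OF assms(1,2)]] assms(3,4)
    by (auto simp: lex_nth_def)
  then show ?thesis
    using mem assms lex_less_linear lex_index_less by (metis less_asym less_irrefl)
qed

abbreviation simplex_nth :: "'n::{finite,linorder} set set \<Rightarrow> nat \<Rightarrow> 'n set" where
  "simplex_nth Feas \<equiv> lex_nth Feas"

abbreviation facet_nth :: "real^'n::{finite,linorder}^'r \<Rightarrow> nat \<Rightarrow> 'n set" where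
  "facet_nth A \<equiv> lex_nth (interior_simplex_facets A)"

definition intfacets :: "real^'n::{finite,linorder}^'r \<Rightarrow> 'n set set \<Rightarrow> nat \<Rightarrow> nat set" where
  "intfacets A Feas s =
     {f \<in> {1..card (interior_simplex_facets A)}. facet_nth A f \<in> facets (simplex_nth Feas s)}"

definition indexes_partial_triangulation ::
    "real^'n::{finite,linorder}^'r \<Rightarrow> 'n set set \<Rightarrow> nat set \<Rightarrow> bool" where
  "indexes_partial_triangulation A Feas T \<longleftrightarrow>
     T \<subseteq> {1..card Feas} \<and> partial_triangulation A Feas (simplex_nth Feas ` T)"

definition indexes_triangulation ::
    "real^'n::{finite,linorder}^'r \<Rightarrow> 'n set set \<Rightarrow> nat set \<Rightarrow> bool" where
  "indexes_triangulation A Feas T \<longleftrightarrow>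
     T \<subseteq> {1..card Feas} \<and> triangulation A Feas (simplex_nth Feas ` T)"

definition adm :: "real^'n::{finite,linorder}^'r \<Rightarrow> 'n set set \<Rightarrow> nat set \<Rightarrow> nat set" where
  "adm A Feas T =
     {s \<in> {1..card Feas}. \<forall>s'\<in>T. s > s' \<and>
        intersect_properly A (simplex_nth Feas s) (simplex_nth Feas s')}"

definition free :: "real^'n::{finite,linorder}^'r \<Rightarrow> 'n set set \<Rightarrow> nat set \<Rightarrow> nat set" where
  "free A Feas T =
     {f \<in> {1..card (interior_simplex_facets A)}. \<exists>!s. s \<in> T \<and> f \<in> intfacets A Feas s}"

definition right_extendable ::
    "real^'n::{finite,linorder}^'r \<Rightarrow> 'n set set \<Rightarrow> nat set \<Rightarrow> bool" where
  "right_extendable A Feas T \<longleftrightarrow>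
     (\<exists>T'. T \<subseteq> T' \<and> indexes_triangulation A Feas T' \<and> (\<forall>s'\<in>T' - T. \<forall>s\<in>T. s' > s))"

end

theory Submission
  imports Defs
begin

text \<open>If \<open>T'\<close> is a triangulation extending \<open>T\<close> to the right, take \<open>C f\<close> to be the set of
  simplices of \<open>T' - T\<close> that have \<open>f\<close> as a facet: a free facet lies in only one simplex of
  \<open>T\<close>, so covering yields a second one in \<open>T' - T\<close>, and any two simplices of \<open>T'\<close> intersect
  properly.\<close>

text \<open>Facet numbers enumerate interior facets only. This supplies the premise under which
  \<open>covering\<close> provides a neighbour.\<close>

lemma facet_nth_interior:
  fixes A :: "real^'n::{finite,linorder}^'r"
  assumes "f \<in> {1..card (interior_simplex_facets A)}"
  shows "interior_face A (facet_nth A f)"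
proof -
  have "bij_betw (facet_nth A) {1..card (interior_simplex_facets A)} (interior_simplex_facets A)"
    by (rule bij_betw_lex_nth) simp_all
  then have "facet_nth A f \<in> interior_simplex_facets A"
    using assms by (rule bij_betwE[rule_format])
  then show ?thesis
    by (simp add: interior_simplex_facets_def)
qed

lemma inj_on_simplex_nth:
  fixes Feas :: "'n::{finite,linorder} set set"
  shows "inj_on (simplex_nth Feas) {1..card Feas}"
  by (rule bij_betw_imp_inj_on[OF bij_betw_lex_nth]) simp_all

text \<open>\<open>partial_triangulation\<close> speaks about distinct sets, not distinct numbers;
  injectivity of the numbering leads from \<open>s \<noteq> s'\<close> to distinct
  simplices.\<close>

lemma indexes_triangulation_intersect_properly:
  fixes A :: "real^'n::{finite,linorder}^'r"
  assumes "indexes_triangulation A Feas T" "s \<in> T" "s' \<in> T" "s \<noteq> s'"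
  shows "intersect_properly A (simplex_nth Feas s) (simplex_nth Feas s')"
proof -
  have "simplex_nth Feas s \<noteq> simplex_nth Feas s'"
    using assms inj_on_simplex_nth[of Feas]
    by (auto simp: indexes_triangulation_def dest: inj_onD)
  with assms show ?thesis
    by (auto simp: indexes_triangulation_def triangulation_def partial_triangulation_def)
qed

text \<open>This is the covering property carried over from sets to their numbers.\<close>

lemma indexes_triangulation_neighbour:
  fixes A :: "real^'n::{finite,linorder}^'r"
  assumes tri: "indexes_triangulation A Feas T" and s: "s \<in> T" and f: "f \<in> intfacets A Feas s"
  obtains s' where "s' \<in> T" "s' \<noteq> s" "f \<in> intfacets A Feas s'"
proof -
  let ?F = "facet_nth A f"
  have fM: "f \<in> {1..card (interior_simplex_facets A)}" and F: "?F \<in> facets (simplex_nth Feas s)"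
    using f by (auto simp: intfacets_def)
  have "covering A (simplex_nth Feas ` T)"
    and simplex: "\<And>t. t \<in> T \<Longrightarrow> simplex_of A (simplex_nth Feas t)"
    using tri by (auto simp: indexes_triangulation_def triangulation_def partial_triangulation_def)
  then obtain s' where s': "s' \<in> T" "simplex_nth Feas s' \<noteq> simplex_nth Feas s"
      "?F \<subseteq> simplex_nth Feas s'"
    using s F facet_nth_interior[OF fM] unfolding covering_def by blast
  \<comment> \<open>Covering yields only the inclusion of \<open>?F\<close> in the second simplex.
    Since both simplices have CARD('r) elements, \<open>?F\<close> has the right size to be a facet
    of it as well.\<close>
  have "card (simplex_nth Feas s') = card (simplex_nth Feas s)"
    using simplex[OF s] simplex[OF s'(1)] by (simp add: simplex_of_def)
  then have "f \<in> intfacets A Feas s'"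
    using fM F s'(3) by (simp add: intfacets_def facets_def)
  with s' show thesis
    by (intro that) auto
qed

theorem theorem12:
  fixes A :: "real^'n::{finite,linorder}^'r"
    and Feas :: "'n set set"
    and T :: "nat set"
  assumes "rank A = CARD('r)"
    and "Feas \<subseteq> {S. simplex_of A S}"
    and "indexes_partial_triangulation A Feas T"
    and "T \<noteq> {}"
    and "right_extendable A Feas T"
  shows "\<exists>C :: nat \<Rightarrow> nat set.
    (\<forall>f \<in> free A Feas T. C f \<subseteq> adm A Feas T) \<and>
    (\<forall>f \<in> free A Feas T. \<exists>s \<in> C f. \<forall>f' \<in> free A Feas T. \<exists>s' \<in> C f'.
       s = s' \<or> intersect_properly A (simplex_nth Feas s) (simplex_nth Feas s')) \<and>
    (\<forall>f \<in> free A Feas T. \<forall>s \<in> C f. f \<in> intfacets A Feas s)"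
proof -
  obtain T' where "T \<subseteq> T'" and tri: "indexes_triangulation A Feas T'"
    and right: "\<And>s s'. s' \<in> T' - T \<Longrightarrow> s \<in> T \<Longrightarrow> s' > s"
    using assms(5) unfolding right_extendable_def by blast
  note proper = indexes_triangulation_intersect_properly[OF tri]
  define C where "C f = {s \<in> T' - T. f \<in> intfacets A Feas s}" for f
  have "T' - T \<subseteq> adm A Feas T"
  proof
    fix s assume s: "s \<in> T' - T"
    then have "s \<in> {1..card Feas}"
      using tri by (auto simp: indexes_triangulation_def)
    \<comment> \<open>\<open>s\<close> lies outside \<open>T\<close> and \<open>s'\<close> inside,
      so they are distinct members of \<open>T'\<close>.\<close>
    moreover have "intersect_properly A (simplex_nth Feas s) (simplex_nth Feas s')"
      if "s' \<in> T" for s'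
      using s that \<open>T \<subseteq> T'\<close> by (intro proper) auto
    ultimately show "s \<in> adm A Feas T"
      using right[OF s] by (simp add: adm_def)
  qed
  then have adm: "\<forall>f \<in> free A Feas T. C f \<subseteq> adm A Feas T"
    by (auto simp: C_def)
  have nonempty: "\<exists>s. s \<in> C f" if f: "f \<in> free A Feas T" for f
  proof -
    obtain s where s: "s \<in> T" "f \<in> intfacets A Feas s"
      and uniq: "\<And>t. t \<in> T \<Longrightarrow> f \<in> intfacets A Feas t \<Longrightarrow> t = s"
      using f unfolding free_def by blast
    obtain s' where "s' \<in> T'" "s' \<noteq> s" "f \<in> intfacets A Feas s'"
      using indexes_triangulation_neighbour[OF tri _ s(2)] s(1) \<open>T \<subseteq> T'\<close> by blast
    \<comment> \<open>If \<open>s'\<close> were in \<open>T\<close>, uniqueness would force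
      \<open>s' = s\<close>.\<close>
    then show ?thesis
      using uniq by (auto simp: C_def)
  qed
  \<comment> \<open>This holds for every pair of covering simplices, so any elements of
    \<open>C f\<close> and \<open>C f'\<close> can serve as witnesses. Equality can occur when one
    simplex of \<open>T' - T\<close> covers both \<open>f\<close> and \<open>f'\<close>.\<close>
  have "s = s' \<or> intersect_properly A (simplex_nth Feas s) (simplex_nth Feas s')"
    if "s \<in> C f" "s' \<in> C f'" for s s' f f'
    using that proper[of s s'] by (auto simp: C_def)
  with nonempty have "\<forall>f \<in> free A Feas T. \<exists>s \<in> C f. \<forall>f' \<in> free A Feas T. \<exists>s' \<in> C f'.
      s = s' \<or> intersect_properly A (simplex_nth Feas s) (simplex_nth Feas s')"
    by meson
  moreover have "\<forall>f \<in> free A Feas T. \<forall>s \<in> C f. f \<in> intfacets A Feas s"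
    by (simp add: C_def)
  ultimately show ?thesis
    using adm by (intro exI[of _ C] conjI)
qed

end
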